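(* Let $A$ be a simple Lie semi-algebra over a semi-field $K$, with product $[\cdot,\cdot]:A\times A\to A$. Then $A$ is abelian, i.e., $[u,v]=0$ for all $u,v\in A$.
   Context: A semi-field $(K,+,\bullet)$ is a commutative semi-ring with unit $1$ (i.e. $(K,+)$ is a commutative monoid with identity $0$, multiplication is associative and commutative with identity $1$, and multiplication distributes over addition) such that $x+y=0$ implies $x=y=0$, and $x\bullet y=0$ implies $x=0$ or $y=0$. A semi-vector space over $K$ is a set $A$ with operations $+:A\times A\to A$ and $\cdot:K\times A\to A$ such that: (1) $(A,+)$ is an abelian monoid (with identity $0$) satisfying the cancellation law $u+v=u+w\Rightarrow v=w$; (2) $\alpha(u+v)=\alpha u+\alpha v$; (3) $(\alpha+\beta)v=\alpha v+\beta v$; (4) $(\alpha\beta)v=\alpha(\beta v)$; (5) $1v=v$. It is simple if the only element $v$ for which there is $u$ with $v+u=0$ is $v=0$. A map $T$ between semi-vector spaces over $K$ is semi-linear if $T(u+v)=T(u)+T(v)$ and $T(\lambda v)=\lambda T(v)$ for all $u,v$ and $\lambda\in K$. A Lie semi-algebra over $K$ is a semi-vector space $A$ over $K$ with a product $[\cdot,\cdot]:A\times A\to A$ that is semi-bilinear (semi-linear in each variable when the other is fixed), satisfies $[v,v]=0$ for all $v\in A$, and satisfies $[u,[v,w]]+[w,[u,v]]+[v,[w,u]]=0$ for all $u,v,w\in A$. It is called simple if it is simple as a semi-vector space. *)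

theory Defs
  imports Main
begin

(* Weaker than comm_semiring_1: neither 0 * x = 0 nor 0 \<noteq> 1 is part of the definition. *)
class semi_field = comm_semiring + comm_monoid_add + comm_monoid_mult +
  assumes add_eq_zeroD: "x + y = 0 \<Longrightarrow> x = 0 \<and> y = 0"
    and mult_eq_zeroD: "x * y = 0 \<Longrightarrow> x = 0 \<or> y = 0"

(* The abelian monoid with cancellation is the sort {comm_monoid_add, cancel_semigroup_add};
   the class cancel_comm_monoid_add would add a subtraction operation to the structure. *)
locale semi_vector_space =
  fixes scale :: "'k::semi_field \<Rightarrow> 'a::{comm_monoid_add, cancel_semigroup_add} \<Rightarrow> 'a"
    (infixr \<open>\<cdot>\<close> 75)
  assumes scale_add_right: "\<alpha> \<cdot> (u + v) = \<alpha> \<cdot> u + \<alpha> \<cdot> v"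
    and scale_add_left: "(\<alpha> + \<beta>) \<cdot> v = \<alpha> \<cdot> v + \<beta> \<cdot> v"
    and scale_mult: "(\<alpha> * \<beta>) \<cdot> v = \<alpha> \<cdot> (\<beta> \<cdot> v)"
    and scale_one: "1 \<cdot> v = v"

locale simple_semi_vector_space = semi_vector_space scale
  for scale :: "'k::semi_field \<Rightarrow> 'a::{comm_monoid_add, cancel_semigroup_add} \<Rightarrow> 'a"
    (infixr \<open>\<cdot>\<close> 75) +
  assumes simple: "(\<exists>u. v + u = 0) \<Longrightarrow> (v :: 'a) = 0"

locale semi_linear =
  V: semi_vector_space scale\<^sub>1 + W: semi_vector_space scale\<^sub>2
  for scale\<^sub>1 :: "'k::semi_field \<Rightarrow> 'a::{comm_monoid_add, cancel_semigroup_add} \<Rightarrow> 'a"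
    and scale\<^sub>2 :: "'k \<Rightarrow> 'b::{comm_monoid_add, cancel_semigroup_add} \<Rightarrow> 'b" +
  fixes T :: "'a \<Rightarrow> 'b"
  assumes add: "T (u + v) = T u + T v"
    and scale: "T (scale\<^sub>1 \<alpha> v) = scale\<^sub>2 \<alpha> (T v)"

locale lie_semi_algebra = semi_vector_space scale
  for scale :: "'k::semi_field \<Rightarrow> 'a::{comm_monoid_add, cancel_semigroup_add} \<Rightarrow> 'a"
    (infixr \<open>\<cdot>\<close> 75) +
  fixes bracket :: "'a \<Rightarrow> 'a \<Rightarrow> 'a"
  assumes semi_linear_left: "semi_linear scale scale (\<lambda>u. bracket u v)"
    and semi_linear_right: "semi_linear scale scale (\<lambda>v. bracket u v)"
    and bracket_self: "bracket v v = 0"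
    and jacobi: "bracket u (bracket v w) + bracket w (bracket u v) + bracket v (bracket w u) = 0"

locale simple_lie_semi_algebra = lie_semi_algebra + simple_semi_vector_space

end

theory Submission
  imports Defs
begin

text \<open>Polarizing \<open>bracket v v = 0\<close> at \<open>u + v\<close> leaves
  \<open>bracket u v + bracket v u = 0\<close>, so every bracket has an additive inverse; in a
  simple space only \<open>0\<close> has one.\<close>

lemma (in lie_semi_algebra) bracket_add_left: "bracket (u + v) w = bracket u w + bracket v w"
  using semi_linear.add[OF semi_linear_left] .

lemma (in lie_semi_algebra) bracket_add_right: "bracket u (v + w) = bracket u v + bracket u w"
  using semi_linear.add[OF semi_linear_right] .

text \<open>Antisymmetry is put as a vanishing sum because there is no negation; this is also the
  form that \<open>simple\<close> consumes.\<close>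

lemma (in lie_semi_algebra) bracket_antisym: "bracket u v + bracket v u = 0"
proof -
  have "bracket u v + bracket v u = bracket (u + v) (u + v)"
    unfolding bracket_add_left bracket_add_right by (simp add: bracket_self add.commute)
  then show ?thesis
    by (simp only: bracket_self)
qed

theorem proposition3p19:
  fixes scale :: "'k::semi_field \<Rightarrow> 'a::{comm_monoid_add, cancel_semigroup_add} \<Rightarrow> 'a"
    and bracket :: "'a \<Rightarrow> 'a \<Rightarrow> 'a"
  assumes "simple_lie_semi_algebra scale bracket"
  shows "\<forall>u v. bracket u v = 0"
proof (intro allI)
  fix u v
  interpret simple_lie_semi_algebra scale bracket by (fact assms)
  show "bracket u v = 0"
    \<comment> \<open>The witness for the existential in \<open>simple\<close> is
      \<open>bracket v u\<close>.\<close>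
    using simple bracket_antisym by blast
qed

end
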